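(* Let $K\subset\mathbb{R}^n$ be a convex body containing the origin in its interior, and suppose that the origin $(0,0)\in\mathbb{R}^n\times\mathbb{R}^n$ is a critical point of $\mathcal{F}_K$. Then the Hessian matrix of $\mathcal{F}_K$ at the origin is $$\operatorname{Hess}_{(0,0)}\mathcal{F}_K=(n+1)\operatorname{vp}(K)\begin{pmatrix}(n+2)\operatorname{cov}(K^\circ) & -I_n\\ -I_n & (n+2)\operatorname{cov}(K)\end{pmatrix}.$$
   Context: For a convex body $K\subset\mathbb{R}^n$ containing the origin in its interior, $K^\circ=\{y\in\mathbb{R}^n\mid \langle x,y\rangle\le 1\ \forall x\in K\}$ is its polar body, $|\cdot|$ is Lebesgue measure, and $\operatorname{vp}(K)=|K|\cdot|K^\circ|$ is the volume product. Define $\mathcal{F}_K(x,\xi)=\operatorname{vp}\big((K^\circ+\xi)^\circ+x\big)$, which is well defined for $(x,\xi)$ in an open neighbourhood $U_K$ of $(0,0)\in\mathbb{R}^n\times\mathbb{R}^n$ (where $0\in\operatorname{int}(K^\circ+\xi)$ and $0\in\operatorname{int}((K^\circ+\xi)^\circ+x)$). For a convex body $A$ with barycenter at the origin, $\operatorname{cov}(A)$ is the symmetric $n\times n$ matrix with entries $\operatorname{cov}(A)_{ij}=\frac1{|A|}\int_A x_ix_j\,dx$. (The origin is a critical point of $\mathcal F_K$ if and only if both $K$ and $K^\circ$ have barycenter at the origin, so the covariance matrices in the claim are defined.) $I_n$ is the $n\times n$ identity matrix. In the block decomposition, the first $n$ coordinates correspond to $x$ and the last $n$ to $\xi$. *)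

theory Defs
  imports "HOL-Analysis.Analysis"
begin

definition polar :: "'a::real_inner set \<Rightarrow> 'a set" where
  "polar K = {y. \<forall>x\<in>K. inner x y \<le> 1}"

definition convex_body :: "'a::euclidean_space set \<Rightarrow> bool" where
  "convex_body K \<longleftrightarrow> compact K \<and> convex K \<and> interior K \<noteq> {}"

definition vp :: "'a::euclidean_space set \<Rightarrow> real" where
  "vp K = measure lebesgue K * measure lebesgue (polar K)"

(* A total function; it is the intended one on the neighbourhood of (0, 0) where both translated
   bodies contain the origin in their interior, and its values elsewhere carry no meaning.
   Criticality and the Hessian at the origin depend only on values near (0, 0). *)
definition vp_shift :: "(real^'n) set \<Rightarrow> (real^'n) \<times> (real^'n) \<Rightarrow> real" where
  "vp_shift K = (\<lambda>(x, \<xi>). vp ((\<lambda>u. u + x) ` polar ((\<lambda>y. y + \<xi>) ` polar K)))"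

definition critical_point :: "('a::real_normed_vector \<Rightarrow> real) \<Rightarrow> 'a \<Rightarrow> bool" where
  "critical_point f z \<longleftrightarrow> (f has_derivative (\<lambda>h. 0)) (at z)"

(* Covariance matrix of a body whose barycenter is the origin: no centering takes place. *)
definition cov :: "(real^'n) set \<Rightarrow> real^'n^'n" where
  "cov A = (\<chi> i j. (LINT x:A|lebesgue. x $ i * x $ j) / measure lebesgue A)"

(* f is differentiable near z, with gradient G, and G is differentiable at z with Jacobian H. *)
definition has_hessian :: "(real^'m \<Rightarrow> real) \<Rightarrow> real^'m^'m \<Rightarrow> real^'m \<Rightarrow> bool" where
  "has_hessian f H z \<longleftrightarrow>
     (\<exists>G. (\<forall>\<^sub>F w in nhds z. (f has_derivative (\<lambda>h. inner (G w) h)) (at w)) \<and>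
          (G has_derivative (\<lambda>h. H *v h)) (at z))"

lemma has_hessian_partials:
  assumes "has_hessian f H z"
  obtains g where
    "\<And>j. \<forall>\<^sub>F w in nhds z. ((\<lambda>t. f (w + t *\<^sub>R axis j 1)) has_real_derivative g j w) (at 0)"
    "\<And>i j. ((\<lambda>t. g j (z + t *\<^sub>R axis i 1)) has_real_derivative H $ j $ i) (at 0)"
proof -
  from assms obtain G where
    G: "\<forall>\<^sub>F w in nhds z. (f has_derivative (\<lambda>h. inner (G w) h)) (at w)"
    and H: "(G has_derivative (\<lambda>h. H *v h)) (at z)"
    unfolding has_hessian_def by blast
  have line: "((\<lambda>t::real. w + t *\<^sub>R axis i 1) has_derivative (\<lambda>t. t *\<^sub>R axis i 1)) (at 0)"
    for w :: "real^'a" and i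
    by (rule has_derivative_eq_rhs, (rule derivative_intros)+, simp)
  have "\<forall>\<^sub>F w in nhds z. ((\<lambda>t. f (w + t *\<^sub>R axis j 1)) has_real_derivative G w $ j) (at 0)" for j
    using G
  proof eventually_elim
    case (elim w)
    have "((\<lambda>t. f (w + t *\<^sub>R axis j 1)) has_derivative
        (\<lambda>t. inner (G w) (t *\<^sub>R axis j 1))) (at 0)"
      using has_derivative_compose[OF line[of w j], of f "\<lambda>h. inner (G w) h"] elim by simp
    then show ?case
      unfolding has_field_derivative_def
      by (rule has_derivative_eq_rhs) (simp add: fun_eq_iff inner_axis)
  qed
  moreover have "((\<lambda>t. G (z + t *\<^sub>R axis i 1) $ j) has_real_derivative H $ j $ i) (at 0)" for i j
  proof -
    have "((\<lambda>t. G (z + t *\<^sub>R axis i 1)) has_derivative (\<lambda>t. H *v (t *\<^sub>R axis i 1))) (at 0)"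
      using has_derivative_compose[OF line[of z i], of G "\<lambda>h. H *v h"] H by simp
    then have "((\<lambda>t. G (z + t *\<^sub>R axis i 1) $ j) has_derivative
        (\<lambda>t. (H *v (t *\<^sub>R axis i 1)) $ j)) (at 0)"
      by (rule bounded_linear.has_derivative[OF bounded_linear_vec_nth])
    moreover have "(H *v (t *\<^sub>R axis i 1)) $ j = H $ j $ i * t" for t
      by (simp add: matrix_vector_mult_scaleR matrix_vector_mult_basis column_def mult.commute)
    ultimately show ?thesis by (simp add: has_field_derivative_def)
  qed
  ultimately show thesis using that[of "\<lambda>j w. G w $ j"] by simp
qed

definition block_matrix ::
    "real^'n^'n \<Rightarrow> real^'n^'n \<Rightarrow> real^'n^'n \<Rightarrow> real^'n^'n \<Rightarrow> real^('n + 'n)^('n + 'n)" where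
  "block_matrix A B C D = (\<chi> i j. case (i, j) of
       (Inl k, Inl l) \<Rightarrow> A $ k $ l
     | (Inl k, Inr l) \<Rightarrow> B $ k $ l
     | (Inr k, Inl l) \<Rightarrow> C $ k $ l
     | (Inr k, Inr l) \<Rightarrow> D $ k $ l)"

(* Inl indexes the first n coordinates, Inr the last n. *)
definition split_vec :: "real^('n + 'n) \<Rightarrow> (real^'n) \<times> (real^'n)" where
  "split_vec z = ((\<chi> i. z $ Inl i), (\<chi> i. z $ Inr i))"

end

theory Submission
  imports Defs "HOL-Probability.Distributions"
begin

text \<open>
Write \<open>L\<close> for the polar of \<open>K\<close> and \<open>n\<close> for the dimension. Translating the polar of a body \<open>M\<close> by a
small vector \<open>x\<close> and taking the polar again gives the image of \<open>M\<close> under the projective map \<open>u \<mapsto> u / (1 + inner x u)\<close>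
(lemma \<open>polar_translate_polar\<close>), whose Jacobian is \<open>(1 + inner x u) powi - (n + 1)\<close>. Applied twice, this gives
the explicit formula
\<open>F (x, \<xi>) = (\<integral>u\<in>K. (1 + inner \<xi> u) powi - (n + 1)) * (\<integral>v\<in>L. (1 + inner x \<xi> + inner x v) powi - (n + 1))\<close>
for the shifted volume product near the origin (lemma \<open>vp_shift_eq_cone_functions\<close>).

The Hessian is then found by differentiating under the integral sign twice. The first derivative at the
origin consists of the barycenters of \<open>L\<close> and \<open>K\<close>, so both vanish at a critical point. The
second derivatives of the powers give \<open>(n + 1) * (n + 2)\<close> times the second moments, that is, the diagonal
blocks; the mixed derivative comes only from the bilinear term \<open>inner x \<xi>\<close> and gives the
off-diagonal blocks, since all other mixed contributions contain a barycenter.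

The volume of the projective image is computed on cones in \<open>n + 1\<close> dimensions, where the projective map becomes
the shear \<open>t = s + inner x y\<close>: integrating \<open>exp (- t)\<close> over both cones and comparing gives the Jacobian
factor as a Gamma integral (lemma \<open>emeasure_polar_translate_polar\<close>). The Taylor estimate behind the
differentiation is in \<open>has_derivative_integral_inner_power_int\<close>.
\<close>

section \<open>Polar bodies and their translates\<close>

text \<open>
The bipolar theorem: a point outside \<open>M\<close> is cut off by a hyperplane that misses the origin, and
the normal of that hyperplane, suitably scaled, lies in the polar.
\<close>
lemma polar_polar:
  fixes M :: "'a::euclidean_space set"
  assumes "closed M" "convex M" "0 \<in> M"
  shows "polar (polar M) = M"
proof
  show "M \<subseteq> polar (polar M)"
    by (auto simp: polar_def inner_commute)
  show "polar (polar M) \<subseteq> M"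
  proof (rule subsetI, rule ccontr)
    fix z assume z: "z \<in> polar (polar M)" "z \<notin> M"
    obtain a b where ab: "inner a z < b" "\<forall>x\<in>M. inner a x > b"
      using separating_hyperplane_closed_point[OF assms(2,1) z(2)] by blast
    have b: "b < 0" using ab(2) assms(3) by force
    define y where "y = a /\<^sub>R b"
    have "y \<in> polar M"
      using ab(2) b by (auto simp: polar_def y_def divide_simps inner_commute dest!: bspec)
    then have "inner y z \<le> 1" using z(1) by (auto simp: polar_def)
    then show False using ab(1) b by (simp add: y_def divide_simps)
  qed
qed

lemma zero_in_polar: "0 \<in> polar K"
  by (simp add: polar_def)

lemma closed_polar: "closed (polar K)"
proof -
  have "polar K = (\<Inter>x\<in>K. {y. inner x y \<le> 1})" by (auto simp: polar_def)
  then show ?thesis by (auto intro!: closed_INT closed_halfspace_le)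
qed

lemma convex_polar: "convex (polar K)"
proof -
  have "polar K = (\<Inter>x\<in>K. {y. inner x y \<le> 1})" by (auto simp: polar_def)
  then show ?thesis by (auto intro!: convex_INT convex_halfspace_le)
qed

lemma bounded_polar:
  assumes "0 \<in> interior K"
  shows "bounded (polar K)"
proof -
  obtain e where e: "e > 0" "cball 0 e \<subseteq> K"
    using assms by (meson mem_interior_cball)
  have "norm y \<le> 1 / e" if y: "y \<in> polar K" for y
  proof (cases "y = 0")
    case False
    have "(e / norm y) *\<^sub>R y \<in> K"
      using e False by (intro subsetD[OF e(2)]) simp
    then have "inner ((e / norm y) *\<^sub>R y) y \<le> 1" using y by (auto simp: polar_def)
    then show ?thesis using e False
      by (simp add: divide_simps power2_norm_eq_inner[symmetric] power2_eq_square mult.commute)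
  qed (use e in auto)
  then show ?thesis by (auto simp: bounded_iff)
qed

lemma zero_in_interior_polar:
  assumes "bounded K"
  shows "0 \<in> interior (polar K)"
proof -
  obtain R where R: "R > 0" "\<And>x. x \<in> K \<Longrightarrow> norm x \<le> R"
    using assms by (meson bounded_pos)
  have "y \<in> polar K" if "norm y \<le> 1 / R" for y
  proof -
    have "inner x y \<le> 1" if "x \<in> K" for x
    proof -
      have "inner x y \<le> norm x * norm y" by (rule norm_cauchy_schwarz)
      also have "\<dots> \<le> R * (1 / R)"
        using R that \<open>norm y \<le> 1 / R\<close> by (intro mult_mono) auto
      finally show ?thesis using R by simp
    qed
    then show ?thesis by (simp add: polar_def)
  qed
  then have "cball 0 (1 / R) \<subseteq> polar K" by auto
  then show ?thesis using R by (meson mem_interior_cball divide_pos_pos zero_less_one)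
qed

text \<open>
Translating the polar body acts on the body itself by the projective map
\<open>u \<mapsto> u / (1 + inner x u)\<close>, here written through its inverse. Indeed, \<open>y\<close> lies in the left-hand side iff
\<open>inner v y \<le> 1 - inner x y\<close> for all \<open>v \<in> polar M\<close>, and for a positive right-hand side the bipolar theorem
turns this into a condition on \<open>M\<close>. The smallness of \<open>x\<close> excludes a right-hand side that is not positive.
\<close>
lemma polar_translate_polar:
  fixes M :: "'a::euclidean_space set"
  assumes M: "closed M" "convex M" "0 \<in> M" and x: "\<And>z. z \<in> M \<Longrightarrow> \<bar>inner x z\<bar> < 1"
  shows "polar ((\<lambda>v. v + x) ` polar M) = {y. inner x y < 1 \<and> y /\<^sub>R (1 - inner x y) \<in> M}"
proof -
  have "y \<in> polar ((\<lambda>v. v + x) ` polar M) \<longleftrightarrow> inner x y < 1 \<and> y /\<^sub>R (1 - inner x y) \<in> M" for y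
  proof -
    have *: "y \<in> polar ((\<lambda>v. v + x) ` polar M) \<longleftrightarrow> (\<forall>v\<in>polar M. inner v y \<le> 1 - inner x y)"
      by (auto simp: polar_def inner_add_left algebra_simps)
    show ?thesis
    proof (cases "inner x y < 1")
      case True
      have "(\<forall>v\<in>polar M. inner v y \<le> 1 - inner x y) \<longleftrightarrow> y /\<^sub>R (1 - inner x y) \<in> polar (polar M)"
        using True by (auto simp: polar_def divide_simps)
      then show ?thesis using * True polar_polar[OF M] by simp
    next
      case False
      have "\<not> (\<forall>v\<in>polar M. inner v y \<le> 1 - inner x y)"
      proof
        assume le: "\<forall>v\<in>polar M. inner v y \<le> 1 - inner x y"
        \<comment> \<open>As the origin lies in the polar, only the boundary case inner x y = 1 remains.\<close>
        then have "0 \<le> 1 - inner x y" using zero_in_polar by fastforce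
        with False have xy: "inner x y = 1" by simp
        then have "y \<in> polar (polar M)"
          using le by (fastforce simp: polar_def)
        then have "y \<in> M" using polar_polar[OF M] by simp
        then show False using x[of y] xy by simp
      qed
      then show ?thesis using * False by simp
    qed
  qed
  then show ?thesis by blast
qed

section \<open>Volumes of projective images by integration over cones\<close>

lemma borel_measurable_power_int [measurable (raw)]:
  fixes f :: "'c \<Rightarrow> real"
  assumes [measurable]: "f \<in> borel_measurable N"
  shows "(\<lambda>v. f v powi m) \<in> borel_measurable N"
  by (cases "m \<ge> 0") (simp_all add: power_int_def)

lemma nn_integral_scaleR:
  fixes f :: "'a::euclidean_space \<Rightarrow> ennreal"
  assumes [measurable]: "f \<in> borel_measurable borel" and c: "c > 0"
  shows "(\<integral>\<^sup>+y. f y \<partial>lborel) = ennreal (c ^ DIM('a)) * (\<integral>\<^sup>+z. f (c *\<^sub>R z) \<partial>lborel)"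
  by (subst lborel_affine[of c "0::'a"])
     (use c in \<open>simp_all add: nn_integral_density nn_integral_distr nn_integral_cmult\<close>)

lemma nn_integral_power_exp:
  assumes c: "c > 0"
  shows "(\<integral>\<^sup>+t. ennreal (t ^ n * exp (- (c * t))) * indicator {0<..} t \<partial>lborel) =
         ennreal (fact n / c ^ Suc n)"
proof -
  have "ennreal (fact n) = (\<integral>\<^sup>+t. ennreal (t ^ n * exp (- t)) * indicator {0..} t \<partial>lborel)"
    by (subst nn_intergal_power_times_exp_Ici) simp
  also have "\<dots> = (\<integral>\<^sup>+t. ennreal (t ^ n * exp (- t)) * indicator {0<..} t \<partial>lborel)"
    using AE_lborel_singleton[of "0::real"]
    by (intro nn_integral_cong_AE) (auto elim!: eventually_mono split: split_indicator)
  also have "\<dots> = ennreal c * (\<integral>\<^sup>+t. ennreal ((c * t) ^ n * exp (- (c * t))) * indicator {0<..} (c * t) \<partial>lborel)"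
    using c by (subst nn_integral_real_affine[where c = c and t = 0]) simp_all
  also have "(\<integral>\<^sup>+t. ennreal ((c * t) ^ n * exp (- (c * t))) * indicator {0<..} (c * t) \<partial>lborel) =
      (\<integral>\<^sup>+t. ennreal (c ^ n) * (ennreal (t ^ n * exp (- (c * t))) * indicator {0<..} t) \<partial>lborel)"
    using c by (intro nn_integral_cong)
      (auto split: split_indicator simp: power_mult_distrib ennreal_mult' [symmetric] mult.assoc
            zero_less_mult_iff)
  also have "\<dots> = ennreal (c ^ n) * (\<integral>\<^sup>+t. ennreal (t ^ n * exp (- (c * t))) * indicator {0<..} t \<partial>lborel)"
    by (rule nn_integral_cmult) simp
  finally have eq: "ennreal (c ^ Suc n) * (\<integral>\<^sup>+t. ennreal (t ^ n * exp (- (c * t))) * indicator {0<..} t \<partial>lborel) = ennreal (fact n)"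
    (is "_ * ?I = _") using c by (simp add: ennreal_mult' mult.assoc)
  have "?I = ennreal (1 / c ^ Suc n) * (ennreal (c ^ Suc n) * ?I)"
    using c by (simp add: mult.assoc[symmetric] ennreal_mult'[symmetric] del: power_Suc)
  also have "\<dots> = ennreal (fact n / c ^ Suc n)"
    unfolding eq using c by (simp add: ennreal_mult'[symmetric])
  finally show ?thesis .
qed

text \<open>
The pairs \<open>(t, y)\<close> with \<open>t > 0\<close> and \<open>y \<in> t S\<close> form the cone over \<open>{1} \<times> S\<close>. Slicing it at height \<open>t\<close>
and rescaling each slice to \<open>S\<close> gives polar coordinates adapted to \<open>S\<close>; the factor \<open>t ^ DIM('a)\<close>
is the Jacobian.
\<close>
lemma nn_integral_cone:
  fixes S :: "'a::euclidean_space set" and q :: "'a \<Rightarrow> ennreal"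
  assumes [measurable]: "S \<in> sets borel" "q \<in> borel_measurable borel"
  shows "(\<integral>\<^sup>+y. (\<integral>\<^sup>+t. indicator {0<..} t * indicator S (y /\<^sub>R t) * ennreal (exp (- t)) * q y \<partial>lborel) \<partial>lborel) =
    (\<integral>\<^sup>+z. (\<integral>\<^sup>+t. ennreal (t ^ DIM('a) * exp (- t)) * q (t *\<^sub>R z) * indicator {0<..} t \<partial>lborel) * indicator S z \<partial>lborel)"
proof -
  have "(\<integral>\<^sup>+y. (\<integral>\<^sup>+t. indicator {0<..} t * indicator S (y /\<^sub>R t) * ennreal (exp (- t)) * q y \<partial>lborel) \<partial>lborel) =
    (\<integral>\<^sup>+t. (\<integral>\<^sup>+y. indicator {0<..} t * indicator S (y /\<^sub>R t) * ennreal (exp (- t)) * q y \<partial>lborel) \<partial>lborel)"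
    by (rule lborel_pair.Fubini') measurable
  also have "\<dots> = (\<integral>\<^sup>+t. (\<integral>\<^sup>+z. ennreal (t ^ DIM('a) * exp (- t)) * q (t *\<^sub>R z) * indicator {0<..} t * indicator S z \<partial>lborel) \<partial>lborel)"
  proof (rule nn_integral_cong)
    fix t :: real
    show "(\<integral>\<^sup>+y. indicator {0<..} t * indicator S (y /\<^sub>R t) * ennreal (exp (- t)) * q y \<partial>lborel) =
      (\<integral>\<^sup>+z. ennreal (t ^ DIM('a) * exp (- t)) * q (t *\<^sub>R z) * indicator {0<..} t * indicator S z \<partial>lborel)"
    proof (cases "t > 0")
      case True
      have "(\<integral>\<^sup>+y. indicator {0<..} t * indicator S (y /\<^sub>R t) * ennreal (exp (- t)) * q y \<partial>lborel) =
        ennreal (t ^ DIM('a)) * (\<integral>\<^sup>+z. indicator {0<..} t * indicator S ((t *\<^sub>R z) /\<^sub>R t) * ennreal (exp (- t)) * q (t *\<^sub>R z) \<partial>lborel)"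
        using True by (subst nn_integral_scaleR[where c = t]) simp_all
      also have "\<dots> = (\<integral>\<^sup>+z. ennreal (t ^ DIM('a)) * (indicator {0<..} t * indicator S ((t *\<^sub>R z) /\<^sub>R t) * ennreal (exp (- t)) * q (t *\<^sub>R z)) \<partial>lborel)"
        by (rule nn_integral_cmult[symmetric]) measurable
      also have "\<dots> = (\<integral>\<^sup>+z. ennreal (t ^ DIM('a) * exp (- t)) * q (t *\<^sub>R z) * indicator {0<..} t * indicator S z \<partial>lborel)"
        using True by (intro nn_integral_cong) (simp add: ennreal_mult' mult_ac)
      finally show ?thesis .
    qed simp
  qed
  also have "\<dots> = (\<integral>\<^sup>+z. (\<integral>\<^sup>+t. ennreal (t ^ DIM('a) * exp (- t)) * q (t *\<^sub>R z) * indicator {0<..} t * indicator S z \<partial>lborel) \<partial>lborel)"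
    by (rule lborel_pair.Fubini') measurable
  also have "\<dots> = (\<integral>\<^sup>+z. (\<integral>\<^sup>+t. ennreal (t ^ DIM('a) * exp (- t)) * q (t *\<^sub>R z) * indicator {0<..} t \<partial>lborel) * indicator S z \<partial>lborel)"
    by (intro nn_integral_cong nn_integral_multc) measurable
  finally show ?thesis .
qed

text \<open>
The volume of the projective image of \<open>M\<close>, obtained without a change of variables for the
projective map. The cone over the image is the cone over \<open>M\<close>, sheared by \<open>t = s + inner x y\<close>. Shears
preserve volume and turn the weight \<open>exp (- t)\<close> into \<open>exp (- s) * exp (- inner x y)\<close>. Integrating the weight
along rays gives \<open>n!\<close> times the volume of the image on one side and the Gamma integral
\<open>n! / (1 + inner x z) ^ (n + 1)\<close> for each \<open>z \<in> M\<close> on the other.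
\<close>
lemma emeasure_polar_translate_polar:
  fixes M :: "'a::euclidean_space set"
  assumes M: "closed M" "convex M" "0 \<in> M" and x: "\<And>z. z \<in> M \<Longrightarrow> \<bar>inner x z\<bar> < 1"
  shows "emeasure lborel (polar ((\<lambda>v. v + x) ` polar M)) =
    (\<integral>\<^sup>+z. ennreal ((1 + inner x z) powi (- int (DIM('a) + 1))) * indicator M z \<partial>lborel)"
proof -
  define S where "S = polar ((\<lambda>v. v + x) ` polar M)"
  define n where "n = DIM('a)"
  have S: "y \<in> S \<longleftrightarrow> inner x y < 1 \<and> y /\<^sub>R (1 - inner x y) \<in> M" for y
    using polar_translate_polar[OF M x] by (simp add: S_def)
  have [measurable]: "M \<in> sets borel" "S \<in> sets borel"
    using M closed_polar unfolding S_def by (auto intro: borel_closed)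
  \<comment> \<open>The shear maps one cone onto the other. Points with s > 0 are sent to points with t > 0 because |inner x z| < 1 on M.\<close>
  have cone_iff: "s + inner x y > 0 \<and> y /\<^sub>R (s + inner x y) \<in> S \<longleftrightarrow> s > 0 \<and> y /\<^sub>R s \<in> M" for s y
  proof (cases "s + inner x y > 0")
    case True
    have "1 - inner x y / (s + inner x y) = s / (s + inner x y)"
      using True by (simp add: field_simps)
    then show ?thesis using True by (auto simp: S divide_simps)
  next
    case False
    have "\<not> (s > 0 \<and> y /\<^sub>R s \<in> M)"
    proof
      assume s: "s > 0 \<and> y /\<^sub>R s \<in> M"
      then have "\<bar>inner x (y /\<^sub>R s)\<bar> < 1" by (intro x) simp
      then show False using s False by (simp add: field_simps abs_less_iff)
    qed
    then show ?thesis using False by simp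
  qed
  have "ennreal (fact n) * emeasure lborel S =
      (\<integral>\<^sup>+z. ennreal (fact n) * indicator S z \<partial>lborel)"
    by (subst nn_integral_cmult) simp_all
  also have "\<dots> = (\<integral>\<^sup>+z. (\<integral>\<^sup>+t. ennreal (t ^ n * exp (- t)) * 1 * indicator {0<..} t \<partial>lborel) * indicator S z \<partial>lborel)"
    using nn_integral_power_exp[of 1 n] by simp
  also have "\<dots> = (\<integral>\<^sup>+y. (\<integral>\<^sup>+t. indicator {0<..} t * indicator S (y /\<^sub>R t) * ennreal (exp (- t)) * 1 \<partial>lborel) \<partial>lborel)"
    unfolding n_def by (rule nn_integral_cone[symmetric]) measurable
  also have "\<dots> = (\<integral>\<^sup>+y. (\<integral>\<^sup>+s. indicator {0<..} s * indicator M (y /\<^sub>R s) * ennreal (exp (- s)) * ennreal (exp (- inner x y)) \<partial>lborel) \<partial>lborel)"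
  proof (rule nn_integral_cong)
    fix y
    have "(\<integral>\<^sup>+t. indicator {0<..} t * indicator S (y /\<^sub>R t) * ennreal (exp (- t)) * 1 \<partial>lborel) =
      (\<integral>\<^sup>+s. indicator {0<..} (inner x y + s) * indicator S (y /\<^sub>R (inner x y + s)) * ennreal (exp (- (inner x y + s))) \<partial>lborel)"
      by (subst nn_integral_real_affine[where c = 1 and t = "inner x y"]) simp_all
    also have "\<dots> = (\<integral>\<^sup>+s. indicator {0<..} s * indicator M (y /\<^sub>R s) * ennreal (exp (- s)) * ennreal (exp (- inner x y)) \<partial>lborel)"
      using cone_iff[of _ y]
      by (intro nn_integral_cong)
         (auto simp: indicator_def ennreal_mult'[symmetric] exp_add[symmetric] add.commute)
    finally show "(\<integral>\<^sup>+t. indicator {0<..} t * indicator S (y /\<^sub>R t) * ennreal (exp (- t)) * 1 \<partial>lborel) = \<dots>" .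
  qed
  also have "\<dots> = (\<integral>\<^sup>+z. (\<integral>\<^sup>+t. ennreal (t ^ n * exp (- t)) * ennreal (exp (- inner x (t *\<^sub>R z))) * indicator {0<..} t \<partial>lborel) * indicator M z \<partial>lborel)"
    unfolding n_def by (rule nn_integral_cone) measurable
  also have "\<dots> = (\<integral>\<^sup>+z. ennreal (fact n) * (ennreal ((1 + inner x z) powi (- int (n + 1))) * indicator M z) \<partial>lborel)"
  proof (rule nn_integral_cong)
    fix z
    show "(\<integral>\<^sup>+t. ennreal (t ^ n * exp (- t)) * ennreal (exp (- inner x (t *\<^sub>R z))) * indicator {0<..} t \<partial>lborel) * indicator M z
      = ennreal (fact n) * (ennreal ((1 + inner x z) powi (- int (n + 1))) * indicator M z)"
    proof (cases "z \<in> M")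
      case True
      have pos: "1 + inner x z > 0" using x[OF True] by auto
      have "(\<integral>\<^sup>+t. ennreal (t ^ n * exp (- t)) * ennreal (exp (- inner x (t *\<^sub>R z))) * indicator {0<..} t \<partial>lborel)
        = (\<integral>\<^sup>+t. ennreal (t ^ n * exp (- ((1 + inner x z) * t))) * indicator {0<..} t \<partial>lborel)"
        by (intro nn_integral_cong)
           (auto simp: ennreal_mult''[symmetric] mult.assoc exp_add[symmetric] algebra_simps
                 split: split_indicator)
      also have "\<dots> = ennreal (fact n / (1 + inner x z) ^ Suc n)"
        by (rule nn_integral_power_exp[OF pos])
      also have "\<dots> = ennreal (fact n) * ennreal ((1 + inner x z) powi (- int (n + 1)))"
        using pos by (subst power_int_minus, subst power_int_of_nat)
          (simp add: ennreal_mult'[symmetric] divide_inverse)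
      finally show ?thesis using True by simp
    qed simp
  qed
  also have "\<dots> = ennreal (fact n) * (\<integral>\<^sup>+z. ennreal ((1 + inner x z) powi (- int (n + 1))) * indicator M z \<partial>lborel)"
    by (rule nn_integral_cmult) (simp add: power_int_def)
  finally have "ennreal (fact n) * emeasure lborel S = ennreal (fact n) * (\<integral>\<^sup>+z. ennreal ((1 + inner x z) powi (- int (n + 1))) * indicator M z \<partial>lborel)" .
  then show ?thesis unfolding S_def n_def
    by (subst (asm) ennreal_mult_cancel_left) auto
qed

lemma integral_lebesgue_on_eq_lborel:
  fixes f :: "'a::euclidean_space \<Rightarrow> 'b::euclidean_space"
  assumes [measurable]: "M \<in> sets borel" "f \<in> borel_measurable borel"
  shows "(\<integral>z. f z \<partial>lebesgue_on M) = (\<integral>z. indicator M z *\<^sub>R f z \<partial>lborel)"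
  by (subst integral_restrict_space) (simp_all add: integral_completion)

lemma integral_lebesgue_on_translation:
  fixes f :: "'a::euclidean_space \<Rightarrow> 'b::euclidean_space"
  assumes M [measurable]: "closed M" and [measurable]: "f \<in> borel_measurable borel"
  shows "(\<integral>z. f z \<partial>lebesgue_on ((\<lambda>y. y + \<xi>) ` M)) = (\<integral>v. f (v + \<xi>) \<partial>lebesgue_on M)"
proof -
  have "closed ((\<lambda>y. y + \<xi>) ` M)"
    using closed_translation[OF M, of \<xi>] by (simp add: add.commute)
  then have [measurable]: "M \<in> sets borel" "(\<lambda>y. y + \<xi>) ` M \<in> sets borel"
    using M by (auto intro: borel_closed)
  have "(\<integral>z. f z \<partial>lebesgue_on ((\<lambda>y. y + \<xi>) ` M)) =
      (\<integral>z. indicator ((\<lambda>y. y + \<xi>) ` M) z *\<^sub>R f z \<partial>distr lborel borel ((+) \<xi>))"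
    by (simp add: integral_lebesgue_on_eq_lborel lborel_distr_plus)
  also have "\<dots> = (\<integral>v. indicator ((\<lambda>y. y + \<xi>) ` M) (\<xi> + v) *\<^sub>R f (\<xi> + v) \<partial>lborel)"
    by (rule integral_distr) measurable
  also have "\<dots> = (\<integral>v. indicator M v *\<^sub>R f (v + \<xi>) \<partial>lborel)"
    by (intro Bochner_Integration.integral_cong) (auto simp: indicator_def add.commute)
  also have "\<dots> = (\<integral>v. f (v + \<xi>) \<partial>lebesgue_on M)"
    by (rule integral_lebesgue_on_eq_lborel[symmetric]) measurable
  finally show ?thesis .
qed

lemma measure_polar_translate_polar:
  fixes M :: "'a::euclidean_space set"
  assumes M: "closed M" "convex M" "0 \<in> M" and x: "\<And>z. z \<in> M \<Longrightarrow> \<bar>inner x z\<bar> < 1"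
  shows "measure lebesgue (polar ((\<lambda>v. v + x) ` polar M)) =
    (\<integral>z. (1 + inner x z) powi (- int (DIM('a) + 1)) \<partial>lebesgue_on M)"
proof -
  have [measurable]: "M \<in> sets borel" using M by (simp add: borel_closed)
  have nonneg: "0 \<le> indicator M z *\<^sub>R (1 + inner x z) powi (- int (DIM('a) + 1))" for z
    using x[of z] by (auto simp: indicator_def simp del: power_int_minus)
  have "measure lebesgue (polar ((\<lambda>v. v + x) ` polar M)) = measure lborel (polar ((\<lambda>v. v + x) ` polar M))"
    by (intro measure_completion) (simp add: borel_closed[OF closed_polar])
  also have "\<dots> = enn2real (\<integral>\<^sup>+z. ennreal ((1 + inner x z) powi (- int (DIM('a) + 1))) * indicator M z \<partial>lborel)"
    unfolding measure_def using emeasure_polar_translate_polar[OF M x] by simp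
  also have "(\<integral>\<^sup>+z. ennreal ((1 + inner x z) powi (- int (DIM('a) + 1))) * indicator M z \<partial>lborel) =
     (\<integral>\<^sup>+z. ennreal (indicator M z *\<^sub>R (1 + inner x z) powi (- int (DIM('a) + 1))) \<partial>lborel)"
    by (intro nn_integral_cong) (auto simp: indicator_def)
  also have "enn2real \<dots> = (\<integral>z. indicator M z *\<^sub>R (1 + inner x z) powi (- int (DIM('a) + 1)) \<partial>lborel)"
    using nonneg by (subst integral_eq_nn_integral) auto
  also have "\<dots> = (\<integral>z. (1 + inner x z) powi (- int (DIM('a) + 1)) \<partial>lebesgue_on M)"
    by (rule integral_lebesgue_on_eq_lborel[symmetric]) measurable
  finally show ?thesis .
qed

section \<open>Differentiation under the integral sign\<close>

text \<open>
The error of the first-order Taylor polynomial of \<open>s \<mapsto> s powi m\<close> is quadratic, uniformly on a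
compact interval of positive numbers. This uniformity allows differentiation under the integral.
\<close>
lemma power_int_remainder_bound:
  fixes c b :: real
  assumes c: "0 < c"
  obtains C where "C \<ge> 0"
    "\<And>s t. s \<in> {c..b} \<Longrightarrow> t \<in> {c..b} \<Longrightarrow>
       \<bar>t powi m - s powi m - of_int m * s powi (m - 1) * (t - s)\<bar> \<le> C * (t - s)\<^sup>2"
proof -
  define diff :: "nat \<Rightarrow> real \<Rightarrow> real" where "diff k = (\<lambda>s. if k = 0 then s powi m
     else if k = 1 then of_int m * s powi (m - 1)
     else of_int m * (of_int (m - 1) * s powi (m - 2)))" for k
  have "continuous_on {c..b} (diff 2)"
    unfolding diff_def using c by (auto intro!: continuous_intros)
  then have "bounded (diff 2 ` {c..b})"
    by (intro compact_imp_bounded compact_continuous_image) auto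
  then obtain C where C: "C > 0" "\<And>u. u \<in> {c..b} \<Longrightarrow> \<bar>diff 2 u\<bar> \<le> C"
    by (auto simp: bounded_pos)
  have "\<bar>t powi m - s powi m - of_int m * s powi (m - 1) * (t - s)\<bar> \<le> C / 2 * (t - s)\<^sup>2"
    if s: "s \<in> {c..b}" and t: "t \<in> {c..b}" for s t
  proof (cases "t = s")
    case False
    have D: "\<forall>k u. k < 2 \<and> c \<le> u \<and> u \<le> b \<longrightarrow> DERIV (diff k) u :> diff (Suc k) u"
    proof (intro allI impI)
      fix k :: nat and u assume *: "k < 2 \<and> c \<le> u \<and> u \<le> b"
      then have u: "u \<noteq> 0" using c by auto
      have "m - 1 - 1 = m - 2" by simp
      moreover have "k = 0 \<or> k = 1" using * by auto
      ultimately show "DERIV (diff k) u :> diff (Suc k) u"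
        using u by (auto simp: diff_def intro!: derivative_eq_intros)
    qed
    have "\<exists>u. (if t < s then t < u \<and> u < s else s < u \<and> u < t) \<and>
        t powi m = (\<Sum>k<2. (diff k s / fact k) * (t - s) ^ k) + (diff 2 u / fact 2) * (t - s) ^ 2"
      by (rule Taylor[where a = c and b = b]) (use D s t False in \<open>auto simp: diff_def\<close>)
    then obtain u where u: "if t < s then t < u \<and> u < s else s < u \<and> u < t"
      and eq: "t powi m = (\<Sum>k<2. (diff k s / fact k) * (t - s) ^ k) + (diff 2 u / fact 2) * (t - s) ^ 2"
      by blast
    have "(\<Sum>k<2. (diff k s / fact k) * (t - s) ^ k) = s powi m + of_int m * s powi (m - 1) * (t - s)"
      by (simp add: diff_def numeral_2_eq_2)
    then have "t powi m - s powi m - of_int m * s powi (m - 1) * (t - s) = diff 2 u / 2 * (t - s)\<^sup>2"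
      using eq by simp
    moreover have "\<bar>diff 2 u\<bar> \<le> C" using u s t by (intro C) (auto split: if_splits)
    ultimately show ?thesis
      using mult_right_mono[of "\<bar>diff 2 u\<bar> / 2" "C / 2" "(t - s)\<^sup>2"]
      by (simp only: abs_mult abs_divide) simp
  qed simp
  with that[of "C / 2"] C(1) show thesis by simp
qed

lemma integrable_inner_power_int:
  fixes \<iota> :: "'c \<Rightarrow> 'e::euclidean_space" and g :: "'c \<Rightarrow> 'f::euclidean_space"
  assumes N: "finite_measure N"
    and [measurable]: "\<iota> \<in> borel_measurable N" "g \<in> borel_measurable N"
    and \<iota>: "\<And>v. v \<in> space N \<Longrightarrow> norm (\<iota> v) \<le> R"
    and g: "\<And>v. v \<in> space N \<Longrightarrow> norm (g v) \<le> B"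
    and c: "c > 0" "\<And>v. v \<in> space N \<Longrightarrow> inner w (\<iota> v) \<ge> c"
  shows "integrable N (\<lambda>v. (inner w (\<iota> v) powi m) *\<^sub>R g v)"
proof -
  interpret finite_measure N by (rule N)
  have "continuous_on {c..norm w * R} (\<lambda>s. s powi m)"
    using c by (auto intro!: continuous_intros)
  then have "bounded ((\<lambda>s. s powi m) ` {c..norm w * R})"
    by (intro compact_imp_bounded compact_continuous_image) auto
  then obtain P where P: "\<forall>s\<in>{c..norm w * R}. \<bar>s powi m\<bar> \<le> P"
    by (auto simp: bounded_iff)
  have "norm ((inner w (\<iota> v) powi m) *\<^sub>R g v) \<le> P * B" if v: "v \<in> space N" for v
  proof -
    have "inner w (\<iota> v) \<le> norm w * norm (\<iota> v)" by (rule norm_cauchy_schwarz)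
    also have "\<dots> \<le> norm w * R" using \<iota>[OF v] by (intro mult_left_mono) auto
    finally have 1: "\<bar>inner w (\<iota> v) powi m\<bar> \<le> P" using P c(2)[OF v] by auto
    then have "0 \<le> P" by linarith
    then show ?thesis using 1 g[OF v] by (auto intro!: mult_mono)
  qed
  then show ?thesis by (intro integrable_const_bound[where B = "P * B"]) auto
qed

text \<open>
Differentiation under the integral sign. Since \<open>\<iota>\<close> is bounded, a small change of \<open>w\<close> keeps all the
numbers \<open>inner w (\<iota> v)\<close> in one compact interval of positive numbers, so that integrating the pointwise
Taylor error gives an error of order \<open>(norm h)\<^sup>2\<close>.
\<close>
lemma has_derivative_integral_inner_power_int:
  fixes \<iota> :: "'c \<Rightarrow> 'e::euclidean_space" and g :: "'c \<Rightarrow> 'f::euclidean_space"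
  assumes N: "finite_measure N"
    and [measurable]: "\<iota> \<in> borel_measurable N" "g \<in> borel_measurable N"
    and \<iota>: "\<And>v. v \<in> space N \<Longrightarrow> norm (\<iota> v) \<le> R"
    and g: "\<And>v. v \<in> space N \<Longrightarrow> norm (g v) \<le> B"
    and c: "c > 0" "\<And>v. v \<in> space N \<Longrightarrow> inner w (\<iota> v) \<ge> c"
  shows "((\<lambda>w. \<integral>v. (inner w (\<iota> v) powi m) *\<^sub>R g v \<partial>N) has_derivative
          (\<lambda>h. \<integral>v. (of_int m * inner w (\<iota> v) powi (m - 1) * inner h (\<iota> v)) *\<^sub>R g v \<partial>N)) (at w)"
proof -
  interpret finite_measure N by (rule N)
  \<comment> \<open>The given bounds may be negative if the space of N is empty, and R may be zero, but R' occurs as a divisor.\<close>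
  define R' where "R' = \<bar>R\<bar> + 1"
  define B' where "B' = \<bar>B\<bar>"
  have R': "R' > 0" "\<And>v. v \<in> space N \<Longrightarrow> norm (\<iota> v) \<le> R'"
    using \<iota> by (fastforce simp: R'_def)+
  have B': "B' \<ge> 0" "\<And>v. v \<in> space N \<Longrightarrow> norm (g v) \<le> B'"
    using g by (fastforce simp: B'_def)+
  have inner_le: "\<bar>inner h (\<iota> v)\<bar> \<le> norm h * R'" if "v \<in> space N" for h v
    by (rule order_trans[OF Cauchy_Schwarz_ineq2]) (intro mult_left_mono R' that norm_ge_zero)
  define b where "b = norm w * R' + c"
  obtain C where C: "C \<ge> 0" "\<And>s t. s \<in> {c/2..b} \<Longrightarrow> t \<in> {c/2..b} \<Longrightarrow>
       \<bar>t powi m - s powi m - of_int m * s powi (m - 1) * (t - s)\<bar> \<le> C * (t - s)\<^sup>2"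
    using power_int_remainder_bound[of "c/2" b m] c by auto
  have s_in: "inner w (\<iota> v) \<in> {c/2..b}" if "v \<in> space N" for v
    using c inner_le[OF that, of w] that by (fastforce simp: b_def)
  \<comment> \<open>For norm (y - w) less than this radius, inner y (\<iota> v) differs from inner w (\<iota> v) by at most c / 2.\<close>
  define \<delta> where "\<delta> = c / (2 * R')"
  have \<delta>: "\<delta> > 0" using c R' by (simp add: \<delta>_def)
  have t_in: "inner y (\<iota> v) \<in> {c/2..b}" if v: "v \<in> space N" and y: "norm (y - w) < \<delta>" for v y
  proof -
    have "\<bar>inner (y - w) (\<iota> v)\<bar> \<le> norm (y - w) * R'" by (rule inner_le[OF v])
    also have "\<dots> \<le> \<delta> * R'" using y R' by (intro mult_right_mono) auto
    also have "\<dots> = c / 2" using R' by (simp add: \<delta>_def)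
    finally have "\<bar>inner y (\<iota> v) - inner w (\<iota> v)\<bar> \<le> c / 2" by (simp add: inner_diff_left)
    then have "inner y (\<iota> v) - inner w (\<iota> v) \<le> c / 2" "inner w (\<iota> v) - inner y (\<iota> v) \<le> c / 2"
      by linarith+
    moreover have "inner w (\<iota> v) \<le> norm w * R'" using inner_le[OF v, of w] by simp
    moreover have "c \<le> inner w (\<iota> v)" by (rule c(2)[OF v])
    ultimately show ?thesis using c(1) unfolding b_def atLeastAtMost_iff by linarith
  qed
  have int0: "integrable N (\<lambda>v. (inner y (\<iota> v) powi k) *\<^sub>R g v)" if y: "norm (y - w) < \<delta>" for y k
    using t_in[OF _ y] c(1) \<iota> g by (intro integrable_inner_power_int[OF N, where c = "c/2"]) auto
  define D where "D h = (\<integral>v. (of_int m * inner w (\<iota> v) powi (m - 1) * inner h (\<iota> v)) *\<^sub>R g v \<partial>N)" for h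
  have "continuous_on {c/2..b} (\<lambda>s. s powi (m - 1))"
    using c by (auto intro!: continuous_intros)
  then have "bounded ((\<lambda>s. s powi (m - 1)) ` {c/2..b})"
    by (intro compact_imp_bounded compact_continuous_image) auto
  then obtain P where P: "\<forall>s\<in>{c/2..b}. \<bar>s powi (m - 1)\<bar> \<le> P"
    by (auto simp: bounded_iff)
  define Q where "Q = \<bar>of_int m\<bar> * \<bar>P\<bar> * R' * B'"
  have D_bound: "norm ((of_int m * inner w (\<iota> v) powi (m - 1) * inner h (\<iota> v)) *\<^sub>R g v) \<le> Q * norm h"
    if v: "v \<in> space N" for v h
  proof -
    have "\<bar>inner w (\<iota> v) powi (m - 1)\<bar> \<le> \<bar>P\<bar>" using P s_in[OF v] by (meson abs_ge_self order_trans)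
    then have "\<bar>of_int m\<bar> * \<bar>inner w (\<iota> v) powi (m - 1)\<bar> * \<bar>inner h (\<iota> v)\<bar> * norm (g v)
       \<le> \<bar>of_int m\<bar> * \<bar>P\<bar> * (norm h * R') * B'"
      using inner_le[OF v] B'(2)[OF v] R' B' by (intro mult_mono mult_nonneg_nonneg) auto
    then show ?thesis by (simp add: abs_mult Q_def mult_ac)
  qed
  have int1: "integrable N (\<lambda>v. (of_int m * inner w (\<iota> v) powi (m - 1) * inner h (\<iota> v)) *\<^sub>R g v)" for h
    using D_bound by (intro integrable_const_bound[where B = "Q * norm h"]) auto
  have D_lin: "bounded_linear D"
  proof (rule bounded_linear_intro)
    show "D (x + y) = D x + D y" for x y
      unfolding D_def
      by (subst Bochner_Integration.integral_add[OF int1 int1, symmetric])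
         (simp add: inner_add_left algebra_simps)
    show "D (r *\<^sub>R x) = r *\<^sub>R D x" for r x
      unfolding D_def
      by (subst Bochner_Integration.integral_scaleR_right[symmetric]) (simp_all add: int1 mult_ac)
    show "norm (D x) \<le> norm x * (measure N (space N) * Q)" for x
    proof -
      have "norm (D x) \<le> (\<integral>v. norm ((of_int m * inner w (\<iota> v) powi (m - 1) * inner x (\<iota> v)) *\<^sub>R g v) \<partial>N)"
        unfolding D_def by (rule integral_norm_bound)
      also have "\<dots> \<le> (\<integral>v. Q * norm x \<partial>N)"
        using D_bound by (intro integral_mono integrable_norm int1) auto
      finally show ?thesis by (simp add: mult_ac)
    qed
  qed
  define E where "E = measure N (space N) * (C * R'\<^sup>2 * B')"
  have "((\<lambda>w. \<integral>v. (inner w (\<iota> v) powi m) *\<^sub>R g v \<partial>N) has_derivative D) (at w)"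
  proof (rule has_derivativeI_sandwich[OF \<delta> D_lin])
    show "((\<lambda>y. E * norm (y - w)) \<longlongrightarrow> 0) (at w)"
      by (auto intro!: tendsto_eq_intros)
    fix y assume "y \<noteq> w" and "dist y w < \<delta>"
    then have y: "norm (y - w) < \<delta>" by (simp add: dist_norm)
    let ?r = "\<lambda>v. inner y (\<iota> v) powi m - inner w (\<iota> v) powi m
               - of_int m * inner w (\<iota> v) powi (m - 1) * inner (y - w) (\<iota> v)"
    have "(\<integral>v. (inner y (\<iota> v) powi m) *\<^sub>R g v \<partial>N) - (\<integral>v. (inner w (\<iota> v) powi m) *\<^sub>R g v \<partial>N) - D (y - w)
        = (\<integral>v. ?r v *\<^sub>R g v \<partial>N)"
      using int0[OF y, of m] int0[of w m] \<delta> int1[of "y - w"]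
      by (simp add: D_def scaleR_diff_left)
    also have "norm \<dots> \<le> (\<integral>v. norm (?r v *\<^sub>R g v) \<partial>N)" by (rule integral_norm_bound)
    also have "\<dots> \<le> (\<integral>v. C * R'\<^sup>2 * B' * (norm (y - w))\<^sup>2 \<partial>N)"
    proof (rule integral_mono)
      show "integrable N (\<lambda>v. norm (?r v *\<^sub>R g v))"
        using int0[OF y, of m] int0[of w m] \<delta> int1[of "y - w"]
        by (auto simp: scaleR_diff_left)
      fix v assume v: "v \<in> space N"
      have "\<bar>?r v\<bar> \<le> C * (inner (y - w) (\<iota> v))\<^sup>2"
        using C(2)[OF s_in[OF v] t_in[OF v y]] by (simp add: inner_diff_left)
      also have "\<dots> \<le> C * (norm (y - w) * R')\<^sup>2"
        using inner_le[OF v, of "y - w"] C(1) abs_le_square_iff[of "inner (y - w) (\<iota> v)" "norm (y - w) * R'"] R'(1)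
        by (intro mult_left_mono) auto
      finally have "\<bar>?r v\<bar> * norm (g v) \<le> C * (norm (y - w) * R')\<^sup>2 * B'"
        using B'(2)[OF v] C(1) by (intro mult_mono) auto
      then show "norm (?r v *\<^sub>R g v) \<le> C * R'\<^sup>2 * B' * (norm (y - w))\<^sup>2"
        by (simp add: power_mult_distrib mult_ac)
    qed simp
    also have "\<dots> = E * norm (y - w) * norm (y - w)"
      by (simp add: E_def power2_eq_square mult_ac)
    finally show "norm ((\<integral>v. (inner y (\<iota> v) powi m) *\<^sub>R g v \<partial>N) - (\<integral>v. (inner w (\<iota> v) powi m) *\<^sub>R g v \<partial>N) - D (y - w))
        / norm (y - w) \<le> E * norm (y - w)"
      using \<open>y \<noteq> w\<close> by (simp add: divide_le_eq)
  qed
  then show ?thesis by (simp add: D_def[abs_def])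
qed

section \<open>The characteristic function of the cone over a body\<close>

text \<open>
Up to the factor \<open>DIM('a)!\<close> this is the Koszul-Vinberg characteristic function
\<open>w \<mapsto> \<integral>c. exp (- inner w c)\<close> of the cone over \<open>{1} \<times> M\<close>, after integration along the rays of the cone. Joining
the constant term and the direction to one vector \<open>w\<close> makes \<open>inner w (1, z)\<close> linear in \<open>w\<close>, and
this serves both the volume of \<open>K\<close> and that of the translated polar body.
\<close>
definition cone_function :: "'a::euclidean_space set \<Rightarrow> real \<times> 'a \<Rightarrow> real" where
  "cone_function M w = (\<integral>z. inner w (1, z) powi (- int (DIM('a) + 1)) \<partial>lebesgue_on M)"

text \<open>
The negative gradient of the cone function, divided by \<open>DIM('a) + 1\<close>.
\<close>
definition cone_moment :: "'a::euclidean_space set \<Rightarrow> real \<times> 'a \<Rightarrow> real \<times> 'a" where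
  "cone_moment M w = (\<integral>z. inner w (1, z) powi (- int (DIM('a) + 2)) *\<^sub>R (1, z) \<partial>lebesgue_on M)"

lemma integrable_lebesgue_on_continuous:
  fixes f :: "'a::euclidean_space \<Rightarrow> 'b::euclidean_space"
  assumes M: "compact M" and f: "continuous_on UNIV f"
  shows "integrable (lebesgue_on M) f"
proof -
  have fin: "finite_measure (lebesgue_on M)"
    by (rule finite_measure_lebesgue_on) (rule lmeasurable_compact[OF M])
  have "bounded (f ` M)"
    using M f by (intro compact_imp_bounded compact_continuous_image) (auto intro: continuous_on_subset)
  then obtain B where "\<And>z. z \<in> M \<Longrightarrow> norm (f z) \<le> B" by (auto simp: bounded_iff)
  moreover have "f \<in> borel_measurable (lebesgue_on M)"
    using borel_measurable_continuous_onI[OF f]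
    by (intro measurable_restrict_space1 measurable_completion) auto
  ultimately show ?thesis
    by (intro finite_measure.integrable_const_bound[OF fin, where B = B])
       (auto simp: space_restrict_space)
qed

text \<open>
Near the vector \<open>(1, 0)\<close>, where \<open>inner w (1, z)\<close> is \<open>1\<close> for all \<open>z\<close>, the bases of the negative powers stay
away from zero. The bound \<open>1 / 2\<close> is an arbitrary positive number below \<open>1\<close>.
\<close>
lemma eventually_cone_pos:
  assumes "bounded M"
  shows "\<forall>\<^sub>F w in nhds (1, 0 :: 'a::euclidean_space). \<forall>z\<in>M. inner w (1::real, z) \<ge> 1 / 2"
proof -
  obtain R where R: "R > 0" "\<And>z. z \<in> M \<Longrightarrow> norm z \<le> R"
    using assms by (meson bounded_pos)
  have "inner w (1, z) \<ge> 1 / 2" if w: "dist w (1, 0) < 1 / (2 * (1 + R))" and z: "z \<in> M" for w :: "real \<times> 'a" and z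
  proof -
    have "norm (1::real, z) \<le> 1 + R"
      using norm_Pair_le[of "1::real" z] R(2)[OF z] by simp
    then have "norm (w - (1, 0)) * norm (1::real, z) \<le> 1 / (2 * (1 + R)) * (1 + R)"
      using w R(1) by (intro mult_mono) (auto simp: dist_norm)
    also have "\<dots> = 1 / 2" using R(1) by (simp add: field_simps)
    finally have "\<bar>inner (w - (1, 0)) (1, z)\<bar> \<le> 1 / 2"
      using Cauchy_Schwarz_ineq2[of "w - (1, 0)" "(1::real, z)"] by linarith
    moreover have "inner (w - (1, 0)) (1, z) = inner w (1, z) - 1" by (simp add: inner_diff_left)
    ultimately show ?thesis by linarith
  qed
  then show ?thesis
    unfolding eventually_nhds_metric using R(1) by (intro exI[of _ "1 / (2 * (1 + R))"]) auto
qed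

lemma
  fixes M :: "'a::euclidean_space set" and g :: "'a \<Rightarrow> 'b::euclidean_space"
  assumes M: "compact M" and g: "continuous_on UNIV g"
    and w: "\<forall>z\<in>M. inner w (1::real, z) \<ge> 1 / 2"
  shows integrable_cone: "integrable (lebesgue_on M) (\<lambda>z. (inner w (1, z) powi m) *\<^sub>R g z)"
    and has_derivative_cone:
      "((\<lambda>w. \<integral>z. (inner w (1, z) powi m) *\<^sub>R g z \<partial>lebesgue_on M) has_derivative
        (\<lambda>h. \<integral>z. (of_int m * inner w (1, z) powi (m - 1) * inner h (1, z)) *\<^sub>R g z \<partial>lebesgue_on M)) (at w)"
proof -
  have fin: "finite_measure (lebesgue_on M)"
    by (rule finite_measure_lebesgue_on) (rule lmeasurable_compact[OF M])
  have cont: "continuous_on UNIV (\<lambda>z::'a. (1::real, z))" by (intro continuous_intros)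
  have bdd: "bounded (f ` M)" if "continuous_on UNIV f" for f :: "'a \<Rightarrow> 'c::euclidean_space"
    using M that by (intro compact_imp_bounded compact_continuous_image) (auto intro: continuous_on_subset)
  obtain B where B: "\<And>z. z \<in> M \<Longrightarrow> norm (g z) \<le> B"
    using bdd[OF g] by (auto simp: bounded_iff)
  obtain R where R: "\<And>z. z \<in> M \<Longrightarrow> norm (1::real, z) \<le> R"
    using bdd[OF cont] by (auto simp: bounded_iff)
  have meas: "(\<lambda>z. (1::real, z)) \<in> borel_measurable (lebesgue_on M)" "g \<in> borel_measurable (lebesgue_on M)"
    using integrable_lebesgue_on_continuous[OF M cont] integrable_lebesgue_on_continuous[OF M g] by auto
  show "integrable (lebesgue_on M) (\<lambda>z. (inner w (1, z) powi m) *\<^sub>R g z)"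
    by (rule integrable_inner_power_int[OF fin meas, where c = "1/2"])
       (use R B w in \<open>auto simp: space_restrict_space\<close>)
  show "((\<lambda>w. \<integral>z. (inner w (1, z) powi m) *\<^sub>R g z \<partial>lebesgue_on M) has_derivative
        (\<lambda>h. \<integral>z. (of_int m * inner w (1, z) powi (m - 1) * inner h (1, z)) *\<^sub>R g z \<partial>lebesgue_on M)) (at w)"
    by (rule has_derivative_integral_inner_power_int[OF fin meas, where c = "1/2"])
       (use R B w in \<open>auto simp: space_restrict_space\<close>)
qed

lemma has_derivative_cone_function:
  fixes M :: "'a::euclidean_space set"
  assumes M: "compact M" and w: "\<forall>z\<in>M. inner w (1::real, z) \<ge> 1 / 2"
  shows "(cone_function M has_derivative (\<lambda>h. - real (DIM('a) + 1) * inner (cone_moment M w) h)) (at w)"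
proof -
  let ?m = "- int (DIM('a) + 1)"
  have cont: "continuous_on UNIV (\<lambda>z::'a. (1::real, z))" by (intro continuous_intros)
  have *: "(\<integral>z. (of_int ?m * inner w (1, z) powi (?m - 1) * inner h (1, z)) *\<^sub>R 1 \<partial>lebesgue_on M)
      = - real (DIM('a) + 1) * inner (cone_moment M w) h" for h
  proof -
    have "?m - 1 = - int (DIM('a) + 2)" by simp
    then have "inner (cone_moment M w) h = (\<integral>z. inner (inner w (1, z) powi (?m - 1) *\<^sub>R (1, z)) h \<partial>lebesgue_on M)"
      unfolding cone_moment_def using integrable_cone[OF M cont w] by (subst integral_inner_left) auto
    then have "- real (DIM('a) + 1) * inner (cone_moment M w) h =
        (\<integral>z. - real (DIM('a) + 1) * inner (inner w (1, z) powi (?m - 1) *\<^sub>R (1, z)) h \<partial>lebesgue_on M)"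
      by simp
    also have "\<dots> = (\<integral>z. (of_int ?m * inner w (1, z) powi (?m - 1) * inner h (1, z)) *\<^sub>R 1 \<partial>lebesgue_on M)"
      by (intro Bochner_Integration.integral_cong refl)
         (simp add: inner_commute[of h] del: scaleR_Pair inner_Pair)
    finally show ?thesis ..
  qed
  have "((\<lambda>w. \<integral>z. (inner w (1, z) powi ?m) *\<^sub>R (1::real) \<partial>lebesgue_on M) has_derivative
      (\<lambda>h. - real (DIM('a) + 1) * inner (cone_moment M w) h)) (at w)"
    using has_derivative_cone[OF M _ w, of "\<lambda>_. 1::real" ?m] unfolding * by simp
  then show ?thesis by (simp add: cone_function_def[abs_def])
qed

lemma has_derivative_cone_moment:
  fixes M :: "'a::euclidean_space set"
  assumes M: "compact M"
  shows "(cone_moment M has_derivative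
    (\<lambda>h. - real (DIM('a) + 2) *\<^sub>R (\<integral>z. inner h (1, z) *\<^sub>R (1, z) \<partial>lebesgue_on M))) (at (1, 0))"
proof -
  let ?m = "- int (DIM('a) + 2)"
  have cont: "continuous_on UNIV (\<lambda>z::'a. (1::real, z))" by (intro continuous_intros)
  have *: "(\<integral>z. (of_int ?m * inner (1, 0) (1::real, z) powi (?m - 1) * inner h (1, z)) *\<^sub>R (1::real, z) \<partial>lebesgue_on M)
      = - real (DIM('a) + 2) *\<^sub>R (\<integral>z. inner h (1, z) *\<^sub>R (1, z) \<partial>lebesgue_on M)" for h
  proof -
    have "- real (DIM('a) + 2) *\<^sub>R (\<integral>z. inner h (1, z) *\<^sub>R (1, z) \<partial>lebesgue_on M)
       = (\<integral>z. - real (DIM('a) + 2) *\<^sub>R (inner h (1, z) *\<^sub>R (1, z)) \<partial>lebesgue_on M)"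
      by (rule integral_scaleR_right[symmetric])
    from this[symmetric] show ?thesis by (simp del: scaleR_Pair)
  qed
  have w: "\<forall>z\<in>M. inner (1, 0) (1::real, z) \<ge> 1 / 2" by simp
  show ?thesis
    using has_derivative_cone[OF M cont w, of ?m] unfolding * cone_moment_def[abs_def] .
qed

lemma cone_function_base: "compact M \<Longrightarrow> cone_function M (1, 0) = measure lebesgue M"
  by (simp add: cone_function_def measure_restrict_space lmeasurable_compact fmeasurableD)

lemma cone_moment_base:
  assumes M: "compact M"
  shows "cone_moment M (1, 0) = (measure lebesgue M, \<integral>z. z \<partial>lebesgue_on M)"
proof -
  have i: "integrable (lebesgue_on M) (\<lambda>z. (1::real, z))"
    by (intro integrable_lebesgue_on_continuous M continuous_intros)
  show ?thesis
    using integral_bounded_linear[OF bounded_linear_fst i] integral_bounded_linear[OF bounded_linear_snd i] M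
    by (intro prod_eqI)
       (simp_all add: cone_moment_def measure_restrict_space lmeasurable_compact fmeasurableD)
qed

lemma snd_second_moment:
  assumes M: "compact M"
  shows "snd (\<integral>z. inner (0, h) (1::real, z) *\<^sub>R (1::real, z) \<partial>lebesgue_on M) = (\<integral>z. inner h z *\<^sub>R z \<partial>lebesgue_on M)"
proof -
  have "integrable (lebesgue_on M) (\<lambda>z. inner (0, h) (1::real, z) *\<^sub>R (1::real, z))"
    by (intro integrable_lebesgue_on_continuous M continuous_intros)
  from integral_bounded_linear[OF bounded_linear_snd this, symmetric] show ?thesis
    by simp
qed

section \<open>The gradient of the shifted volume product\<close>

lemma measure_polar_translate_eq_cone_function:
  fixes K :: "'a::euclidean_space set"
  assumes K: "compact K" "convex K" "0 \<in> K" and x: "\<And>z. z \<in> K \<Longrightarrow> \<bar>inner x z\<bar> < 1"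
  shows "measure lebesgue (polar ((\<lambda>v. v + x) ` polar K)) = cone_function K (1, x)"
  using measure_polar_translate_polar[OF compact_imp_closed[OF K(1)] K(2,3) x]
  by (simp add: cone_function_def)

text \<open>
The first factor of the volume product is the volume of a translate of \<open>polar (polar K + \<xi>)\<close>, a
projective image of \<open>K\<close>. The second one is the volume of the polar of that translate, hence a
projective image of \<open>polar K + \<xi>\<close>; moving the integral back to \<open>polar K\<close> produces the additional term
\<open>inner x \<xi>\<close>. This term is the origin of the off-diagonal blocks of the Hessian.
\<close>
lemma vp_shift_eq_cone_functions:
  fixes K :: "(real^'n) set"
  assumes K: "compact K" "convex K" "0 \<in> interior K"
    and \<xi>: "\<And>u. u \<in> K \<Longrightarrow> \<bar>inner \<xi> u\<bar> < 1"
    and x: "\<And>v. v \<in> polar K \<Longrightarrow> \<bar>inner x (v + \<xi>)\<bar> < 1"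
  shows "vp_shift K (x, \<xi>) = cone_function K (1, \<xi>) * cone_function (polar K) (1 + inner x \<xi>, x)"
proof -
  define M where "M = (\<lambda>v. v + \<xi>) ` polar K"
  have 0: "0 \<in> K" using K(3) interior_subset by blast
  have M_closed: "closed M" "convex M"
    using closed_translation[OF closed_polar, of \<xi> K] convex_translation[OF convex_polar, of \<xi> K]
    by (simp_all add: M_def add.commute)
  have "- \<xi> \<in> polar K"
    using \<xi> by (fastforce simp: polar_def inner_commute)
  then have M0: "0 \<in> M" by (force simp: M_def)
  have "measure lebesgue ((\<lambda>u. u + x) ` polar M) = measure lebesgue (polar M)"
    using measure_translation[of x "polar M"] by (simp add: add.commute)
  also have "\<dots> = cone_function K (1, \<xi>)"
    unfolding M_def by (rule measure_polar_translate_eq_cone_function[OF K(1,2) 0 \<xi>])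
  finally have 1: "measure lebesgue ((\<lambda>u. u + x) ` polar M) = cone_function K (1, \<xi>)" .
  have "measure lebesgue (polar ((\<lambda>u. u + x) ` polar M)) =
      (\<integral>z. (1 + inner x z) powi (- int (CARD('n) + 1)) \<partial>lebesgue_on M)"
    using measure_polar_translate_polar[OF M_closed M0, of x] x by (auto simp: M_def)
  also have "\<dots> = (\<integral>v. (1 + inner x (v + \<xi>)) powi (- int (CARD('n) + 1)) \<partial>lebesgue_on (polar K))"
    unfolding M_def by (rule integral_lebesgue_on_translation[OF closed_polar]) measurable
  also have "\<dots> = cone_function (polar K) (1 + inner x \<xi>, x)"
    by (simp add: cone_function_def inner_add_right add_ac)
  finally show ?thesis using 1 by (simp add: vp_shift_def vp_def M_def)
qed

lemma eventually_vp_shift_eq: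
  fixes K :: "(real^'n) set"
  assumes K: "compact K" "convex K" "0 \<in> interior K"
  shows "\<forall>\<^sub>F p in nhds (0, 0). vp_shift K p =
    cone_function K (1, snd p) * cone_function (polar K) (1 + inner (fst p) (snd p), fst p)"
proof -
  obtain R1 where R1: "\<And>z. z \<in> K \<Longrightarrow> norm z \<le> R1"
    using compact_imp_bounded[OF K(1)] by (meson bounded_iff)
  obtain R2 where R2: "\<And>z. z \<in> polar K \<Longrightarrow> norm z \<le> R2"
    using bounded_polar[OF K(3)] by (meson bounded_iff)
  define R where "R = max 1 (max R1 R2)"
  have R: "R \<ge> 1" "\<And>z. z \<in> K \<Longrightarrow> norm z \<le> R" "\<And>z. z \<in> polar K \<Longrightarrow> norm z \<le> R"
    using R1 R2 by (fastforce simp: R_def)+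
  have "vp_shift K p = cone_function K (1, snd p) * cone_function (polar K) (1 + inner (fst p) (snd p), fst p)"
    if p: "dist p (0, 0) < 1 / (2 * R)" for p
  proof -
    obtain x \<xi> where p_eq: "p = (x, \<xi>)" by (cases p)
    have x: "norm x \<le> 1 / (2 * R)" and \<xi>: "norm \<xi> \<le> 1 / (2 * R)"
      using p norm_fst_le[of x \<xi>] norm_snd_le[of \<xi> x]
      by (auto simp: p_eq dist_norm)
    have *: "norm a * b < 1" if "norm a \<le> 1 / (2 * R)" "b \<le> R + 1 / 2" for a :: "real^'n" and b
    proof -
      have "norm a * b \<le> norm a * (R + 1 / 2)" using that by (intro mult_left_mono) auto
      also have "\<dots> \<le> 1 / (2 * R) * (R + 1 / 2)" using that R by (intro mult_right_mono) auto
      also have "\<dots> < 1" using R(1) by (simp add: field_simps)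
      finally show ?thesis .
    qed
    show ?thesis
      unfolding p_eq fst_conv snd_conv
    proof (rule vp_shift_eq_cone_functions[OF K])
      fix u assume u: "u \<in> K"
      show "\<bar>inner \<xi> u\<bar> < 1"
        using Cauchy_Schwarz_ineq2[of \<xi> u] *[OF \<xi>, of "norm u"] R(2)[OF u] by linarith
    next
      fix v assume v: "v \<in> polar K"
      have "1 / (2 * R) \<le> 1 / 2" using R(1) by (simp add: field_simps)
      then have "norm (v + \<xi>) \<le> R + 1 / 2"
        using norm_triangle_ineq[of v \<xi>] R(3)[OF v] \<xi> by linarith
      then show "\<bar>inner x (v + \<xi>)\<bar> < 1"
        using Cauchy_Schwarz_ineq2[of x "v + \<xi>"] *[OF x, of "norm (v + \<xi>)"] by linarith
    qed
  qed
  then show ?thesis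
    unfolding eventually_nhds_metric using R(1) by (intro exI[of _ "1 / (2 * R)"]) auto
qed

text \<open>
The gradient that the product rule gives for the product of the two cone functions: \<open>A\<close>, \<open>B\<close> are the
two factors, \<open>A'\<close>, \<open>B'\<close> the corresponding moments. The summands with \<open>fst B'\<close> come from the bilinear
term \<open>inner x \<xi>\<close>.
\<close>
definition vp_shift_grad :: "(real^'n) set \<Rightarrow> (real^'n) \<times> (real^'n) \<Rightarrow> (real^'n) \<times> (real^'n)" where
  "vp_shift_grad K p =
     (let A = cone_function K (1, snd p); A' = cone_moment K (1, snd p);
          w = (1 + inner (fst p) (snd p), fst p);
          B = cone_function (polar K) w; B' = cone_moment (polar K) w
      in - real (CARD('n) + 1) *\<^sub>R
           (A *\<^sub>R (snd B' + fst B' *\<^sub>R snd p), B *\<^sub>R snd A' + (A * fst B') *\<^sub>R fst p))"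

lemma eventually_has_derivative_vp_shift:
  fixes K :: "(real^'n) set"
  assumes K: "compact K" "convex K" "0 \<in> interior K"
  shows "\<forall>\<^sub>F p in nhds (0, 0). (vp_shift K has_derivative (\<lambda>h. inner (vp_shift_grad K p) h)) (at p)"
proof -
  have L: "compact (polar K)"
    using bounded_polar[OF K(3)] closed_polar by (simp add: compact_eq_bounded_closed)
  have t1: "((\<lambda>p. (1, snd p)) \<longlongrightarrow> (1, 0)) (nhds (0::real^'n, 0::real^'n))"
    and t2: "((\<lambda>p. (1 + inner (fst p) (snd p), fst p)) \<longlongrightarrow> (1, 0)) (nhds (0::real^'n, 0::real^'n))"
    by (auto intro!: tendsto_eq_intros filterlim_ident)
  have e1: "\<forall>\<^sub>F p in nhds (0::real^'n, 0::real^'n). \<forall>z\<in>K. inner (1, snd p) (1::real, z) \<ge> 1 / 2"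
    using eventually_compose_filterlim[OF eventually_cone_pos[OF compact_imp_bounded[OF K(1)]] t1] .
  have e2: "\<forall>\<^sub>F p in nhds (0::real^'n, 0::real^'n). \<forall>z\<in>polar K. inner (1 + inner (fst p) (snd p), fst p) (1::real, z) \<ge> 1 / 2"
    using eventually_compose_filterlim[OF eventually_cone_pos[OF compact_imp_bounded[OF L]] t2] .
  from eventually_eventually[THEN iffD2, OF eventually_vp_shift_eq[OF K]] e1 e2
  show ?thesis
  proof eventually_elim
    case (elim p)
    let ?U = "\<lambda>p::(real^'n) \<times> (real^'n). (1::real, snd p)"
    let ?W = "\<lambda>p::(real^'n) \<times> (real^'n). (1 + inner (fst p) (snd p), fst p)"
    have U: "(?U has_derivative (\<lambda>h. (0, snd h))) (at p)"
      by (auto intro!: derivative_eq_intros)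
    have W: "(?W has_derivative (\<lambda>h. (inner (fst p) (snd h) + inner (fst h) (snd p), fst h))) (at p)"
      by (auto intro!: derivative_eq_intros)
    have dA: "((\<lambda>p. cone_function K (?U p)) has_derivative
        (\<lambda>h. - real (CARD('n) + 1) * inner (cone_moment K (?U p)) (0, snd h))) (at p)"
      using has_derivative_compose[OF U, OF has_derivative_cone_function[OF K(1) elim(2)]] by simp
    have dB: "((\<lambda>p. cone_function (polar K) (?W p)) has_derivative
        (\<lambda>h. - real (CARD('n) + 1) * inner (cone_moment (polar K) (?W p))
              (inner (fst p) (snd h) + inner (fst h) (snd p), fst h))) (at p)"
      using has_derivative_compose[OF W, OF has_derivative_cone_function[OF L elim(3)]] by simp
    have "((\<lambda>p. cone_function K (?U p) * cone_function (polar K) (?W p)) has_derivative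
        (\<lambda>h. inner (vp_shift_grad K p) h)) (at p)"
      by (rule has_derivative_eq_rhs[OF has_derivative_mult[OF dA dB]])
        (simp add: fun_eq_iff vp_shift_grad_def Let_def inner_prod_def inner_add_left inner_add_right
          algebra_simps inner_commute)
    then show ?case
      by (rule has_derivative_transform_eventually)
        (use elim(1) eventually_nhds_x_imp_x[OF elim(1)] in
          \<open>auto simp: eventually_at_filter elim!: eventually_mono\<close>)
  qed
qed

text \<open>
At the origin the gradient consists of the two barycenters, up to the volumes and a constant. As the
volumes are positive for convex bodies, criticality centers both of them.
\<close>
lemma vp_shift_grad_zero:
  fixes K :: "(real^'n) set"
  assumes K: "compact K" "compact (polar K)"
  shows "vp_shift_grad K (0, 0) = - real (CARD('n) + 1) *\<^sub>R
    (measure lebesgue K *\<^sub>R (\<integral>z. z \<partial>lebesgue_on (polar K)),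
     measure lebesgue (polar K) *\<^sub>R (\<integral>z. z \<partial>lebesgue_on K))"
  using K by (simp add: vp_shift_grad_def Let_def cone_function_base cone_moment_base)

text \<open>
When both bodies are centered, the derivatives of the two cone functions vanish at the origin, and
so do the moments multiplied by them. What remains are the second moments, from the derivatives of
the moments \<open>A'\<close>, \<open>B'\<close>, and the volumes in front of the bilinear term.
\<close>
lemma has_derivative_vp_shift_grad:
  fixes K :: "(real^'n) set"
  defines "L \<equiv> polar K"
  assumes K: "compact K" "compact L"
    and bary: "(\<integral>z. z \<partial>lebesgue_on K) = 0" "(\<integral>z. z \<partial>lebesgue_on L) = 0"
  shows "(vp_shift_grad K has_derivative (\<lambda>h. real (CARD('n) + 1) *\<^sub>R
     (measure lebesgue K *\<^sub>R (real (CARD('n) + 2) *\<^sub>R (\<integral>z. inner (fst h) z *\<^sub>R z \<partial>lebesgue_on L)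
        - measure lebesgue L *\<^sub>R snd h),
      measure lebesgue L *\<^sub>R (real (CARD('n) + 2) *\<^sub>R (\<integral>z. inner (snd h) z *\<^sub>R z \<partial>lebesgue_on K)
        - measure lebesgue K *\<^sub>R fst h)))) (at (0, 0))"
proof -
  let ?U = "\<lambda>p::(real^'n) \<times> (real^'n). (1::real, snd p)"
  let ?W = "\<lambda>p::(real^'n) \<times> (real^'n). (1 + inner (fst p) (snd p), fst p)"
  let ?N = "real (CARD('n) + 1)" and ?N' = "real (CARD('n) + 2)"
  let ?SK = "\<lambda>h. \<integral>z. inner h z *\<^sub>R z \<partial>lebesgue_on K" and ?SL = "\<lambda>h. \<integral>z. inner h z *\<^sub>R z \<partial>lebesgue_on L"
  have U: "(?U has_derivative (\<lambda>h. (0, snd h))) (at (0, 0))"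
    by (auto intro!: derivative_eq_intros)
  have W: "(?W has_derivative (\<lambda>h. (0, fst h))) (at (0, 0))"
    by (auto intro!: derivative_eq_intros)
  have pos: "\<forall>z\<in>M. inner (1, 0) (1::real, z) \<ge> 1 / 2" for M :: "(real^'n) set" by simp
  have "((\<lambda>p. cone_function K (?U p)) has_derivative
      (\<lambda>h. - ?N * inner (cone_moment K (1, 0)) (0, snd h))) (at (0, 0))"
    using has_derivative_compose[OF U, of "cone_function K"] has_derivative_cone_function[OF K(1) pos] by simp
  then have dA: "((\<lambda>p. cone_function K (?U p)) has_derivative (\<lambda>h. 0)) (at (0, 0))"
    by (simp add: cone_moment_base K bary)
  have "((\<lambda>p. cone_function L (?W p)) has_derivative
      (\<lambda>h. - ?N * inner (cone_moment L (1, 0)) (0, fst h))) (at (0, 0))"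
    using has_derivative_compose[OF W, of "cone_function L"] has_derivative_cone_function[OF K(2) pos] by simp
  then have dB: "((\<lambda>p. cone_function L (?W p)) has_derivative (\<lambda>h. 0)) (at (0, 0))"
    by (simp add: cone_moment_base K bary)
  have A': "((\<lambda>p. cone_moment K (?U p)) has_derivative
      (\<lambda>h. - ?N' *\<^sub>R (\<integral>z. inner (0::real, snd h) (1, z) *\<^sub>R (1, z) \<partial>lebesgue_on K))) (at (0, 0))"
    using has_derivative_compose[OF U, unfolded snd_conv, OF has_derivative_cone_moment[OF K(1)]] by simp
  have B': "((\<lambda>p. cone_moment L (?W p)) has_derivative
      (\<lambda>h. - ?N' *\<^sub>R (\<integral>z. inner (0::real, fst h) (1, z) *\<^sub>R (1, z) \<partial>lebesgue_on L))) (at (0, 0))"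
    using has_derivative_compose[OF W, unfolded fst_conv snd_conv inner_zero_left add_0_right, OF has_derivative_cone_moment[OF K(2)]] by simp
  have dA': "((\<lambda>p. snd (cone_moment K (?U p))) has_derivative (\<lambda>h. - ?N' *\<^sub>R ?SK (snd h))) (at (0, 0))"
    using has_derivative_snd[OF A'] by (simp only: snd_scaleR snd_second_moment[OF K(1)])
  have dB': "((\<lambda>p. snd (cone_moment L (?W p))) has_derivative (\<lambda>h. - ?N' *\<^sub>R ?SL (fst h))) (at (0, 0))"
    using has_derivative_snd[OF B'] by (simp only: snd_scaleR snd_second_moment[OF K(2)])
  note db = has_derivative_fst[OF B']
  have dfst: "((\<lambda>p::(real^'n) \<times> (real^'n). fst p) has_derivative fst) (at (0, 0))"
    and dsnd: "((\<lambda>p::(real^'n) \<times> (real^'n). snd p) has_derivative snd) (at (0, 0))"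
    by (auto intro!: derivative_eq_intros)
  note D1 = has_derivative_scaleR[OF dA has_derivative_add[OF dB' has_derivative_scaleR[OF db dsnd]]]
  note D2 = has_derivative_add[OF has_derivative_scaleR[OF dB dA']
      has_derivative_scaleR[OF has_derivative_mult[OF dA db] dfst]]
  note D = has_derivative_scaleR_right[OF has_derivative_Pair[OF D1 D2], of "- ?N"]
  show ?thesis
    unfolding vp_shift_grad_def[abs_def] Let_def L_def[symmetric]
    by (rule has_derivative_eq_rhs[OF D])
      (simp add: fun_eq_iff cone_function_base cone_moment_base K bary algebra_simps)
qed

section \<open>The Hessian in block form\<close>

definition join_vec :: "(real^'n) \<times> (real^'n) \<Rightarrow> real^('n + 'n)" where
  "join_vec p = (\<chi> i. case i of Inl k \<Rightarrow> fst p $ k | Inr k \<Rightarrow> snd p $ k)"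

lemma sum_UNIV_sum: "(\<Sum>i\<in>(UNIV :: ('n::finite + 'n) set). f i) = (\<Sum>k\<in>UNIV. f (Inl k)) + (\<Sum>k\<in>UNIV. f (Inr k))"
  by (subst UNIV_sum, subst sum.union_disjoint) (auto simp: sum.reindex)

lemma inner_join_vec: "inner (join_vec p) h = inner p (split_vec h)"
  by (simp add: inner_vec_def sum_UNIV_sum join_vec_def split_vec_def inner_prod_def)

lemma bounded_linear_split_vec: "bounded_linear split_vec"
  unfolding linear_conv_bounded_linear[symmetric]
  by (rule linearI) (simp_all add: split_vec_def vec_eq_iff)

lemma bounded_linear_join_vec: "bounded_linear join_vec"
  unfolding linear_conv_bounded_linear[symmetric]
  by (rule linearI) (simp_all add: join_vec_def vec_eq_iff split: sum.split)

lemma scaleR_join_vec: "c *\<^sub>R join_vec p = join_vec (c *\<^sub>R p)"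
  by (simp add: linear_cmul[OF bounded_linear.linear[OF bounded_linear_join_vec]])

lemma block_matrix_vector_mult:
  "block_matrix A B C D *v h = join_vec (A *v fst (split_vec h) + B *v snd (split_vec h),
     C *v fst (split_vec h) + D *v snd (split_vec h))"
  by (simp add: vec_eq_iff matrix_vector_mult_def block_matrix_def join_vec_def split_vec_def
      sum_UNIV_sum split: sum.split)

lemma second_moment_eq_cov:
  fixes M :: "(real^'n) set"
  assumes M: "compact M" and pos: "measure lebesgue M \<noteq> 0"
  shows "(\<integral>z. inner h z *\<^sub>R z \<partial>lebesgue_on M) = measure lebesgue M *\<^sub>R (cov M *v h)"
proof -
  have [measurable]: "M \<in> sets borel" using M by (simp add: borel_compact)
  have ij: "measure lebesgue M * cov M $ i $ j = (\<integral>z. z $ i * z $ j \<partial>lebesgue_on M)" for i j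
    using pos by (simp add: cov_def set_lebesgue_integral_def integral_restrict_space)
  have "(\<integral>z. inner h z *\<^sub>R z \<partial>lebesgue_on M) $ i = (measure lebesgue M *\<^sub>R (cov M *v h)) $ i" for i
  proof -
    have "integrable (lebesgue_on M) (\<lambda>z. inner h z *\<^sub>R z)"
      by (intro integrable_lebesgue_on_continuous M continuous_intros)
    from integral_bounded_linear[OF bounded_linear_vec_nth this, symmetric]
    have "(\<integral>z. inner h z *\<^sub>R z \<partial>lebesgue_on M) $ i = (\<integral>z. (\<Sum>j\<in>UNIV. h $ j * (z $ i * z $ j)) \<partial>lebesgue_on M)"
      by (simp add: inner_vec_def sum_distrib_right sum_distrib_left mult_ac)
    also have "\<dots> = (\<Sum>j\<in>UNIV. \<integral>z. h $ j * (z $ i * z $ j) \<partial>lebesgue_on M)"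
      by (intro Bochner_Integration.integral_sum integrable_lebesgue_on_continuous M continuous_intros)
    also have "\<dots> = (\<Sum>j\<in>UNIV. h $ j * (measure lebesgue M * cov M $ i $ j))"
      by (simp only: ij integral_mult_right_zero)
    also have "\<dots> = (measure lebesgue M *\<^sub>R (cov M *v h)) $ i"
      by (simp add: matrix_vector_mult_def sum_distrib_left mult_ac del: measure_completion)
    finally show ?thesis .
  qed
  then show ?thesis by (intro vec_eq_iff[THEN iffD2] allI)
qed

text \<open>
Guards the division by the volume in the definition of the covariance matrix.
\<close>
lemma measure_nonzero_of_interior:
  fixes M :: "'a::euclidean_space set"
  assumes "compact M" "interior M \<noteq> {}"
  shows "measure lebesgue M \<noteq> 0"
proof -
  have "\<not> negligible M"
    using assms(2) interior_subset negligible_subset open_interior open_not_negligible by metis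
  then show ?thesis
    using negligible_iff_measure0[OF lmeasurable_compact[OF assms(1)]] by blast
qed

theorem proposition2p2:
  fixes K :: "(real^'n) set"
  assumes "convex_body K" and "0 \<in> interior K"
    and "critical_point (vp_shift K) (0, 0)"
  shows "has_hessian (\<lambda>z. vp_shift K (split_vec z))
           (((real CARD('n) + 1) * vp K) *\<^sub>R
             block_matrix ((real CARD('n) + 2) *\<^sub>R cov (polar K)) (- mat 1)
                          (- mat 1) ((real CARD('n) + 2) *\<^sub>R cov K))
           0"
proof -
  define L where "L = polar K"
  have K: "compact K" "convex K" using assms(1) by (auto simp: convex_body_def)
  have L: "compact L"
    using bounded_polar[OF assms(2)] closed_polar by (simp add: L_def compact_eq_bounded_closed)
  have volK: "measure lebesgue K \<noteq> 0"
    using measure_nonzero_of_interior[OF K(1)] assms(2) by blast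
  have volL: "measure lebesgue L \<noteq> 0"
    using measure_nonzero_of_interior[OF L] zero_in_interior_polar[OF compact_imp_bounded[OF K(1)]] by (auto simp: L_def)
  note grad = eventually_has_derivative_vp_shift[OF K assms(2)]
  have "(\<lambda>h. inner (vp_shift_grad K (0, 0)) h) = (\<lambda>h. 0)"
    using eventually_nhds_x_imp_x[OF grad] assms(3) unfolding critical_point_def
    by (rule has_derivative_unique)
  then have "inner (vp_shift_grad K (0, 0)) (vp_shift_grad K (0, 0)) = 0"
    by (rule fun_cong)
  then have "vp_shift_grad K (0, 0) = 0" by simp
  then have bary: "(\<integral>z. z \<partial>lebesgue_on K) = 0" "(\<integral>z. z \<partial>lebesgue_on L) = 0"
    using volK volL vp_shift_grad_zero[OF K(1) L[unfolded L_def]] by (auto simp: L_def zero_prod_def)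
  note hess = has_derivative_vp_shift_grad[OF K(1) L[unfolded L_def] bary[unfolded L_def], folded L_def]
  define G where "G z = join_vec (vp_shift_grad K (split_vec z))" for z
  have split0: "split_vec 0 = (0, 0)"
    by (simp add: split_vec_def vec_eq_iff)
  have split_deriv: "(split_vec has_derivative split_vec) (at w)" for w
    by (rule bounded_linear_imp_has_derivative[OF bounded_linear_split_vec])
  have "((\<lambda>z. split_vec z) \<longlongrightarrow> (0, 0)) (nhds 0)"
    using bounded_linear.tendsto[OF bounded_linear_split_vec filterlim_ident, of 0]
    by (simp add: split0)
  from eventually_compose_filterlim[OF grad this]
  have "\<forall>\<^sub>F w in nhds 0. ((\<lambda>z. vp_shift K (split_vec z)) has_derivative (\<lambda>h. inner (G w) h)) (at w)"
    by eventually_elim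
      (auto simp: G_def inner_join_vec dest: has_derivative_compose[OF split_deriv])
  moreover have "(G has_derivative (\<lambda>h. (((real CARD('n) + 1) * vp K) *\<^sub>R
             block_matrix ((real CARD('n) + 2) *\<^sub>R cov (polar K)) (- mat 1)
                          (- mat 1) ((real CARD('n) + 2) *\<^sub>R cov K)) *v h)) (at 0)"
  proof -
    note D = bounded_linear.has_derivative[OF bounded_linear_join_vec
        has_derivative_compose[OF split_deriv[of 0], unfolded split0, OF hess]]
    have neg: "(- mat 1) *v y = - y" for y :: "real^'n"
      by (simp add: matrix_vector_mult_def vec_eq_iff sum_negf mat_def if_distrib[where f = "\<lambda>c. c * _"] cong: if_cong)
    have rhs: "(((real CARD('n) + 1) * vp K) *\<^sub>R
             block_matrix ((real CARD('n) + 2) *\<^sub>R cov (polar K)) (- mat 1)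
                          (- mat 1) ((real CARD('n) + 2) *\<^sub>R cov K)) *v h =
        join_vec (((real CARD('n) + 1) * vp K) *\<^sub>R
          ((real CARD('n) + 2) *\<^sub>R (cov L *v fst (split_vec h)) - snd (split_vec h),
           (real CARD('n) + 2) *\<^sub>R (cov K *v snd (split_vec h)) - fst (split_vec h)))" for h
      by (simp add: scaleR_matrix_vector_assoc[symmetric] block_matrix_vector_mult neg
          scaleR_join_vec L_def)
    show ?thesis
      unfolding G_def[abs_def] rhs
      by (rule has_derivative_eq_rhs[OF D])
        (simp add: fun_eq_iff second_moment_eq_cov K L volK volL vp_def L_def[symmetric]
          algebra_simps del: measure_completion)
  qed
  ultimately show ?thesis unfolding has_hessian_def by blast
qed

end
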